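(* Let $F:\mathbb{R}^d\to\mathbb{R}$ be continuously differentiable and bounded from below, with $\|\nabla F(x)-\nabla F(y)\|\le L\|x-y\|$ for all $x,y\in\mathbb{R}^d$, where $L>0$. Consider the adaptive algorithm AAMMSU described in the context, with parameters $\mu\in(0,1)$, $M>0$, $\nu>0$, $\varepsilon>0$, $\beta_2\in(0,1)$ and positive deterministic $(\eta_n)$, whose stochastic gradients $g_n$ are evaluated at the shifted iterates $z_n$. Assume that $\mathbb{E}[F(w_1)]<+\infty$ and that there are an increasing sequence of $\sigma$-fields $(\mathcal{F}_n)_{n\ge1}$ and constants $\sigma>0$, $\mathcal{K}>0$ such that, for every $n\ge1$: $w_n,z_n,\lambda_n,\alpha_n$ are $\mathcal{F}_n$-measurable; $\mathbb{E}[g_n\mid\mathcal{F}_n]=\nabla F(z_n)$; $\mathbb{E}[\|g_n-\nabla F(z_n)\|^2\mid\mathcal{F}_n]\le\sigma^2$ almost surely; and $\|g_n\|\le\mathcal{K}$ almost surely. Let $B$ be a constant such that $\frac{\|1-\tilde\gamma_n\|^2}{1-\mu}\le B$ almost surely for all $n\ge2$, and assume that, for every $n$ considered, componentwise and almost surely, $$\alpha_n\le\frac{1}{2L\left(M+\frac{B}{2\mu^2}\frac{(M-1)^2}{M}\right)}.$$ Let $N\ge1$ be a final iteration and $C>0$ a constant. (i) If $\eta_n=\frac{C}{\sqrt N}$ for $1\le n\le N$, then $\mathbb{E}\big[\min_{n=1,\dots,N}\|\nabla F(z_n)\|^2\big]\le\mathcal{O}\left(\frac{1}{\sqrt N}\right)$.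 (ii) If $\eta_n=\frac{C}{\sqrt n}$, then $\mathbb{E}\big[\min_{n=1,\dots,N}\|\nabla F(z_n)\|^2\big]\le\mathcal{O}\left(\frac{\log N}{\sqrt N}\right)$ (for $N\ge2$). Here the constants hidden in $\mathcal{O}(\cdot)$ do not depend on $N$.
   Context: All norms are Euclidean; $\odot$, quotients, square roots, maxima, $[u]^2$, sums of a vector and a scalar, and inequalities between vectors/scalars are componentwise. A vector is positive if all its components are positive. Stepsizes. With $v_0=\tilde v_0=0$, for $n\ge1$, $$\tilde v_n=\beta_2\tilde v_{n-1}+(1-\beta_2)[g_n]^2,\qquad v_n=\max\{v_{n-1},\tilde v_n\},\qquad a_n=\frac{\eta_n}{\varepsilon+\sqrt{v_n}},\qquad \alpha_n=\nu a_n,\qquad \lambda_n=M\alpha_n .$$ Inertial coefficients. $\mu_1=1$, $\mu_n=\mu$ for $n\ge2$; $\tilde\gamma_n\in\mathbb{R}^d$ are positive vectors forming a bounded sequence, with $\tilde\gamma_1=(1,\dots,1)$. Underlying two-step accelerated gradient method (2SAGM), from given $(\theta_1,w_1)$: for $n\ge1$, $$z_n=(1-\tilde\gamma_n)\odot\theta_n+\tilde\gamma_n\odot w_n,\quad y_n=(1-\mu_n)\theta_n+\mu_n w_n,\quad w_{n+1}=w_n-\lambda_n\odot g_n,\quad \theta_{n+1}=y_n-\alpha_n\odot g_n .$$ AAMMSU (Adaptive Accelerated Momentum Method with Shifted Updates) is the equivalent form $$p_{n+1}=\tau_n\odot p_n+\nu\, g_n-k_n\odot g_{n-1},\qquad \theta_{n+1}=\theta_n-r_n\odot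 p_{n+1},$$ with the following coefficients for $n\ge3$ (its first iterates being those of 2SAGM, and $p_n=-(\theta_n-\theta_{n-1})/r_{n-1}$): $r_n=a_n$, $\beta_n=\frac{\mu_n}{\mu_{n-1}}(1-\mu_{n-1})$, $\gamma_n=\frac{1-\mu_{n-1}}{\mu_{n-1}}\tilde\gamma_n$, $\omega_n=\lambda_{n-1}-\frac{\alpha_{n-1}}{\mu_{n-1}}$, $\tau_n=\beta_n\frac{r_{n-1}}{r_n}$, $k_n=-\mu_n\frac{\omega_n}{r_n}$, where the point at which $g_n$ is evaluated is $z_n=\theta_n-\gamma_n\odot r_{n-1}\odot p_n-\tilde\gamma_n\odot\omega_n\odot g_{n-1}$. This is the same sequence $(z_n)$ (and $(\theta_n)$) as in 2SAGM, and $w_n$ in the claim refers to the 2SAGM form. The random vector $g_n$ is a noisy evaluation of $\nabla F$ at $z_n$. *)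

theory Defs
  imports "HOL-Probability.Probability"
begin

text \<open>
  On \<^typ>\<open>real ^ 'd\<close> the operator \<open>*\<close> is the componentwise product, \<open>\<le>\<close> the componentwise order
  and \<open>1\<close> the all-ones vector. There is no componentwise quotient, and \<open>max\<close> on vectors is not the
  componentwise maximum because \<open>\<le>\<close> is only a partial order, so both are spelled out.
\<close>

definition vec_div :: "real ^ 'd \<Rightarrow> real ^ 'd \<Rightarrow> real ^ 'd" (infixl \<open>\<oslash>\<close> 70)
  where "x \<oslash> y = (\<chi> i. x $ i / y $ i)"

text \<open>
  One trajectory of the algorithm. Sequences are indexed from 1; the values at 0 of all sequences
  other than \<open>vtilde\<close> and \<open>vmax\<close> are irrelevant. The gradients \<open>g\<close> are an arbitrary sequence here.
  They are tied to the points \<open>z n\<close> only in the locale \<open>stochastic_aammsu\<close>.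
\<close>

locale aammsu =
  fixes \<mu> M \<nu> \<epsilon> \<beta>2 :: real
    and \<eta> :: "nat \<Rightarrow> real"
    and \<gamma>t :: "nat \<Rightarrow> real ^ 'd"
    and g :: "nat \<Rightarrow> real ^ 'd"
begin

primrec vtilde :: "nat \<Rightarrow> real ^ 'd" where
  "vtilde 0 = 0"
| "vtilde (Suc n) = \<beta>2 *\<^sub>R vtilde n + (1 - \<beta>2) *\<^sub>R (g (Suc n) * g (Suc n))"

primrec vmax :: "nat \<Rightarrow> real ^ 'd" where
  "vmax 0 = 0"
| "vmax (Suc n) = (\<chi> i. max (vmax n $ i) (vtilde (Suc n) $ i))"

definition a :: "nat \<Rightarrow> real ^ 'd"
  where "a n = (\<chi> i. \<eta> n / (\<epsilon> + sqrt (vmax n $ i)))"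

definition alpha :: "nat \<Rightarrow> real ^ 'd"
  where "alpha n = \<nu> *\<^sub>R a n"

definition lam :: "nat \<Rightarrow> real ^ 'd"
  where "lam n = M *\<^sub>R alpha n"

definition mu :: "nat \<Rightarrow> real"
  where "mu n = (if n = 1 then 1 else \<mu>)"

definition two_sagm ::
  "real ^ 'd \<Rightarrow> real ^ 'd \<Rightarrow> (nat \<Rightarrow> real ^ 'd) \<Rightarrow> (nat \<Rightarrow> real ^ 'd) \<Rightarrow> (nat \<Rightarrow> real ^ 'd) \<Rightarrow>
   (nat \<Rightarrow> real ^ 'd) \<Rightarrow> bool"
  where "two_sagm \<theta>1 w1 \<theta> w z y \<longleftrightarrow>
    \<theta> 1 = \<theta>1 \<and> w 1 = w1 \<and>
    (\<forall>n\<ge>1. z n = (1 - \<gamma>t n) * \<theta> n + \<gamma>t n * w n \<and>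
            y n = (1 - mu n) *\<^sub>R \<theta> n + mu n *\<^sub>R w n \<and>
            w (n + 1) = w n - lam n * g n \<and>
            \<theta> (n + 1) = y n - alpha n * g n)"

definition r :: "nat \<Rightarrow> real ^ 'd"
  where "r n = a n"

definition beta :: "nat \<Rightarrow> real"
  where "beta n = mu n / mu (n - 1) * (1 - mu (n - 1))"

definition gam :: "nat \<Rightarrow> real ^ 'd"
  where "gam n = ((1 - mu (n - 1)) / mu (n - 1)) *\<^sub>R \<gamma>t n"

definition omega :: "nat \<Rightarrow> real ^ 'd"
  where "omega n = lam (n - 1) - (1 / mu (n - 1)) *\<^sub>R alpha (n - 1)"

definition tau :: "nat \<Rightarrow> real ^ 'd"
  where "tau n = beta n *\<^sub>R (r (n - 1) \<oslash> r n)"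

definition k :: "nat \<Rightarrow> real ^ 'd"
  where "k n = - (mu n *\<^sub>R (omega n \<oslash> r n))"

text \<open>
  The iterates \<open>\<theta>\<close>, \<open>p\<close>, \<open>z\<close> obey the momentum recursion for \<open>n \<ge> 3\<close>; what that recursion needs as
  initial data is supplied by 2SAGM. The sequence \<open>w\<close> is that of 2SAGM run on the same gradients.
\<close>

definition is_aammsu ::
  "real ^ 'd \<Rightarrow> real ^ 'd \<Rightarrow> (nat \<Rightarrow> real ^ 'd) \<Rightarrow> (nat \<Rightarrow> real ^ 'd) \<Rightarrow> (nat \<Rightarrow> real ^ 'd) \<Rightarrow>
   (nat \<Rightarrow> real ^ 'd) \<Rightarrow> bool"
  where "is_aammsu \<theta>1 w1 \<theta> p z w \<longleftrightarrow>
    (\<exists>\<theta>' z' y'. two_sagm \<theta>1 w1 \<theta>' w z' y' \<and>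
       (\<forall>n\<in>{1,2,3}. \<theta> n = \<theta>' n) \<and> (\<forall>n\<in>{1,2}. z n = z' n)) \<and>
    p 3 = - ((\<theta> 3 - \<theta> 2) \<oslash> r 2) \<and>
    (\<forall>n\<ge>3. z n = \<theta> n - gam n * r (n - 1) * p n - \<gamma>t n * omega n * g (n - 1) \<and>
            p (n + 1) = tau n * p n + \<nu> *\<^sub>R g n - k n * g (n - 1) \<and>
            \<theta> (n + 1) = \<theta> n - r n * p (n + 1))"

end

text \<open>
  A run with random gradients \<open>g\<close>; \<open>G\<close> is the gradient field of the objective and \<open>Fl\<close> the
  filtration. The stepsize bound is required only up to the final iteration \<open>N\<close>. The vector
  conditional expectation is taken componentwise, and the conditional second moment is the
  \<^typ>\<open>ennreal\<close>-valued one, which is meaningful without any integrability.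
\<close>

locale stochastic_aammsu = prob_space P
  for P :: "'w measure"
    and G :: "real ^ 'd \<Rightarrow> real ^ 'd"
    and L \<mu> M \<nu> \<epsilon> \<beta>2 \<sigma> K B :: real
    and \<theta>1 w1 :: "'w \<Rightarrow> real ^ 'd"
    and N :: nat
    and \<eta> :: "nat \<Rightarrow> real"
    and \<gamma>t :: "nat \<Rightarrow> 'w \<Rightarrow> real ^ 'd"
    and Fl :: "nat \<Rightarrow> 'w measure"
    and g \<theta> p z w :: "nat \<Rightarrow> 'w \<Rightarrow> real ^ 'd" +
  assumes eta_pos: "\<And>n. n \<ge> 1 \<Longrightarrow> 0 < \<eta> n"
    and gamma_one: "\<And>\<omega>. \<omega> \<in> space P \<Longrightarrow> \<gamma>t 1 \<omega> = 1"
    and gamma_pos: "\<And>\<omega> n i. \<omega> \<in> space P \<Longrightarrow> n \<ge> 1 \<Longrightarrow> 0 < \<gamma>t n \<omega> $ i"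
    and gamma_bounded: "\<And>\<omega>. \<omega> \<in> space P \<Longrightarrow> bounded ((\<lambda>n. \<gamma>t n \<omega>) ` {1..})"
    and algorithm: "\<And>\<omega>. \<omega> \<in> space P \<Longrightarrow>
          aammsu.is_aammsu \<mu> M \<nu> \<epsilon> \<beta>2 \<eta> (\<lambda>n. \<gamma>t n \<omega>) (\<lambda>n. g n \<omega>) (\<theta>1 \<omega>) (w1 \<omega>)
            (\<lambda>n. \<theta> n \<omega>) (\<lambda>n. p n \<omega>) (\<lambda>n. z n \<omega>) (\<lambda>n. w n \<omega>)"
    and sub_sigma: "\<And>n. n \<ge> 1 \<Longrightarrow> subalgebra P (Fl n)"
    and increasing: "\<And>m n. 1 \<le> m \<Longrightarrow> m \<le> n \<Longrightarrow> sets (Fl m) \<subseteq> sets (Fl n)"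
    and g_measurable: "\<And>n. n \<ge> 1 \<Longrightarrow> g n \<in> borel_measurable P"
    and w_measurable: "\<And>n. n \<ge> 1 \<Longrightarrow> w n \<in> borel_measurable (Fl n)"
    and z_measurable: "\<And>n. n \<ge> 1 \<Longrightarrow> z n \<in> borel_measurable (Fl n)"
    and lam_measurable: "\<And>n. n \<ge> 1 \<Longrightarrow>
          (\<lambda>\<omega>. aammsu.lam M \<nu> \<epsilon> \<beta>2 \<eta> (\<lambda>n. g n \<omega>) n) \<in> borel_measurable (Fl n)"
    and alpha_measurable: "\<And>n. n \<ge> 1 \<Longrightarrow>
          (\<lambda>\<omega>. aammsu.alpha \<nu> \<epsilon> \<beta>2 \<eta> (\<lambda>n. g n \<omega>) n) \<in> borel_measurable (Fl n)"
    and unbiased: "\<And>n i. n \<ge> 1 \<Longrightarrow>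
          AE \<omega> in P. real_cond_exp P (Fl n) (\<lambda>\<omega>. g n \<omega> $ i) \<omega> = G (z n \<omega>) $ i"
    and variance_bound: "\<And>n. n \<ge> 1 \<Longrightarrow>
          AE \<omega> in P. nn_cond_exp P (Fl n) (\<lambda>\<omega>. ennreal ((norm (g n \<omega> - G (z n \<omega>)))\<^sup>2)) \<omega>
                       \<le> ennreal (\<sigma>\<^sup>2)"
    and g_bound: "\<And>n. n \<ge> 1 \<Longrightarrow> AE \<omega> in P. norm (g n \<omega>) \<le> K"
    and gamma_B: "\<And>n. n \<ge> 2 \<Longrightarrow> AE \<omega> in P. (norm (1 - \<gamma>t n \<omega>))\<^sup>2 / (1 - \<mu>) \<le> B"
    and alpha_bound: "\<And>n i. 1 \<le> n \<Longrightarrow> n \<le> N \<Longrightarrow>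
          AE \<omega> in P. aammsu.alpha \<nu> \<epsilon> \<beta>2 \<eta> (\<lambda>n. g n \<omega>) n $ i
                       \<le> 1 / (2 * L * (M + B / (2 * \<mu>\<^sup>2) * ((M - 1)\<^sup>2 / M)))"

end

theory Submission
  imports Defs
begin

text \<open>
  AAMMSU is 2SAGM in other variables (\<open>two_sagm_of_is_aammsu\<close>), and in 2SAGM the sequence \<open>w\<close> is an
  ordinary gradient descent, \<open>w (n + 1) = w n - lam n * g n\<close>, except that the gradient is taken at \<open>z n\<close>
  instead of \<open>w n\<close>. The descent inequality for \<open>F\<close> along \<open>w\<close>, rewritten with the gradient at \<open>z n\<close>
  (\<open>descent_shifted\<close>), says that \<open>F (w (n + 1))\<close> is at most

  \<open>F (w n) - inner (G (z n)) (lam n * g n) + L / 2 * (norm (w n - z n))\<^sup>2 + L * (norm (lam n * g n))\<^sup>2\<close>.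

  On almost every trajectory the sums of both error terms are of the order of \<open>\<Sum>n\<le>N. (\<eta> n)\<^sup>2\<close>:
  \<^item> since \<open>vmax\<close> lies between \<open>0\<close> and \<open>K\<^sup>2\<close>, every stepsize component lies between fixed multiples of
    \<open>\<eta> n\<close>, so \<open>lam n * g n\<close> is of order \<open>\<eta> n\<close>;
  \<^item> the discrepancy \<open>w n - y n\<close> starts at \<open>0\<close>, is contracted by \<open>1 - \<mu>\<close> in every step and receives an
    increment of order \<open>\<eta> n\<close>. A convexity argument (\<open>sum_power2_contraction_le\<close>) bounds its sum of
    squares by that of the increments, and \<open>norm (w n - z n)\<close> is at most a multiple of
    \<open>norm (w n - y n)\<close> (\<open>sum_dist_le\<close>).

  Telescoping (\<open>sum_inner_le\<close>) bounds \<open>\<Sum>n\<le>N. inner (G (z n)) (lam n * g n)\<close> by \<open>F w1 - F_inf\<close>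
  plus a constant times \<open>\<Sum>n\<le>N. (\<eta> n)\<^sup>2\<close>. Only now are expectations taken, and since everything random in the
  telescoped inequality is bounded except \<open>F w1\<close>, integrability of \<open>F\<close> along the later
  iterates never enters. As \<open>lam n\<close> and \<open>z n\<close> are \<open>Fl n\<close>-measurable, \<open>g n\<close> may be
  replaced by its conditional expectation \<open>G (z n)\<close>, and by the lower bound on the stepsizes the
  expected summand is at least a multiple of \<open>\<eta> n\<close> times the expectation of \<open>(norm (G (z n)))\<^sup>2\<close>
  (\<open>expectation_inner_ge\<close>). Hence the expected minimum is at most of the order of
  \<open>(1 + (\<Sum>n\<le>N. (\<eta> n)\<^sup>2)) / (\<Sum>n\<le>N. \<eta> n)\<close> (\<open>expectation_min_le\<close>). For \<open>\<eta> n = C / sqrt N\<close> the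
  numerator is bounded, for \<open>\<eta> n = C / sqrt n\<close> it grows like a harmonic sum; in both cases the
  denominator is at least \<open>C * sqrt N\<close>.
\<close>

section \<open>Smooth functions\<close>

locale smooth_objective =
  fixes F :: "'a::euclidean_space \<Rightarrow> real" and G :: "'a \<Rightarrow> 'a" and L F_inf :: real
  assumes gradient: "GDERIV F x :> G x"
    and L_pos: "0 < L"
    and lipschitz: "norm (G x - G y) \<le> L * norm (x - y)"
    and lower_bound: "F_inf \<le> F x"
begin

text \<open>
  Along the segment from \<open>x\<close> to \<open>x + d\<close> the difference of both sides is antitone, because its
  derivative compares \<open>G\<close> at two points at distance \<open>t * norm d\<close>.
\<close>

lemma descent: "F (x + d) \<le> F x + inner (G x) d + L / 2 * (norm d)\<^sup>2"
proof -
  define \<psi> where "\<psi> t = F (x + t *\<^sub>R d) - t * inner (G x) d - L / 2 * t\<^sup>2 * (norm d)\<^sup>2" for t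
  define \<psi>' where "\<psi>' t = inner (G (x + t *\<^sub>R d) - G x) d - L * t * (norm d)\<^sup>2" for t
  have "(\<psi> has_real_derivative \<psi>' t) (at t)" for t
  proof -
    have "((\<lambda>t. x + t *\<^sub>R d) has_derivative (\<lambda>h. h *\<^sub>R d)) (at t)"
      by (auto intro!: derivative_eq_intros)
    moreover have "(F has_derivative (\<lambda>h. inner h (G (x + t *\<^sub>R d)))) (at (x + t *\<^sub>R d))"
      using gradient[of "x + t *\<^sub>R d"] by (simp add: gderiv_def inner_commute)
    ultimately have "((\<lambda>t. F (x + t *\<^sub>R d)) has_derivative (\<lambda>h. inner (h *\<^sub>R d) (G (x + t *\<^sub>R d)))) (at t)"
      by (rule has_derivative_compose)
    then have "((\<lambda>t. F (x + t *\<^sub>R d)) has_real_derivative inner (G (x + t *\<^sub>R d)) d) (at t)"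
      by (simp add: has_field_derivative_def inner_commute mult.commute mult_commute_abs)
    then show ?thesis
      unfolding \<psi>_def[abs_def] \<psi>'_def
      by (auto intro!: derivative_eq_intros simp: inner_diff_left)
  qed
  moreover have "\<psi>' t \<le> 0" if "0 \<le> t" for t
  proof -
    have "inner (G (x + t *\<^sub>R d) - G x) d \<le> norm (G (x + t *\<^sub>R d) - G x) * norm d"
      by (rule norm_cauchy_schwarz)
    also have "\<dots> \<le> (L * norm (t *\<^sub>R d)) * norm d"
      using lipschitz[of "x + t *\<^sub>R d" x] by (intro mult_right_mono) auto
    also have "\<dots> = L * t * (norm d)\<^sup>2"
      using that by (simp add: power2_eq_square)
    finally show ?thesis by (simp add: \<psi>'_def)
  qed
  ultimately have "\<psi> 1 \<le> \<psi> 0"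
    by (intro DERIV_nonpos_imp_nonincreasing[of 0 1 \<psi>]) auto
  then show ?thesis by (simp add: \<psi>_def)
qed

text \<open>
  Moving the gradient to another point \<open>z\<close> costs \<open>L * norm (x - z) * norm d\<close>, which Young's
  inequality splits into two squares. For the algorithm this is applied with \<open>x = w n\<close> and \<open>z = z n\<close>.
\<close>

lemma descent_shifted:
  "F (x + d) \<le> F x + inner (G z) d + L / 2 * (norm (x - z))\<^sup>2 + L * (norm d)\<^sup>2"
proof -
  have "inner (G x) d - inner (G z) d \<le> norm (G x - G z) * norm d"
    using norm_cauchy_schwarz[of "G x - G z" d] by (simp add: inner_diff_left)
  also have "\<dots> \<le> (L * norm (x - z)) * norm d"
    using lipschitz[of x z] by (rule mult_right_mono) auto
  also have "\<dots> = L * (norm (x - z) * norm d)" by simp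
  also have "\<dots> \<le> L * ((norm (x - z))\<^sup>2 / 2 + (norm d)\<^sup>2 / 2)"
    using L_pos sum_squares_bound[of "norm (x - z)" "norm d"] by (intro mult_left_mono) auto
  finally show ?thesis using descent[of x d] by (simp add: algebra_simps)
qed

end

section \<open>One trajectory\<close>

lemma norm_mult_le_vec:
  fixes x y :: "real ^ 'd"
  assumes "\<And>i. \<bar>x $ i\<bar> \<le> c"
  shows "norm (x * y) \<le> c * norm y"
proof -
  have "norm (x * y) \<le> norm (c *\<^sub>R y)"
    using assms by (intro norm_le_componentwise_cart)
      (auto simp: abs_mult intro!: mult_right_mono order.trans[OF assms])
  moreover have "0 \<le> c" using assms[of undefined] by linarith
  ultimately show ?thesis by simp
qed

text \<open>
  The right-hand side of \<open>step\<close> is the convex combination of \<open>u n\<close> and \<open>d n / (1 - q)\<close> with weights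
  \<open>q\<close> and \<open>1 - q\<close>. Convexity of the square therefore leaves a surplus \<open>(1 - q) * (u n)\<^sup>2\<close> in each
  step, which telescopes.
\<close>

lemma sum_power2_contraction_le:
  fixes u d :: "nat \<Rightarrow> real" and q :: real
  assumes q: "0 \<le> q" "q < 1" and u: "\<And>n. 0 \<le> u n" "u 1 = 0"
    and step: "\<And>n. n \<ge> 1 \<Longrightarrow> u (n + 1) \<le> q * u n + d n"
  shows "(\<Sum>n=1..N. (u n)\<^sup>2) \<le> (\<Sum>n=1..N. (d n)\<^sup>2) / (1 - q)\<^sup>2"
proof -
  have sq: "(u (n + 1))\<^sup>2 + (1 - q) * (u n)\<^sup>2 \<le> (u n)\<^sup>2 + (d n)\<^sup>2 / (1 - q)" if "n \<ge> 1" for n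
  proof -
    have "(u (n + 1))\<^sup>2 \<le> (q * u n + d n)\<^sup>2"
      using step[OF that] u(1) by (intro power_mono) auto
    also have "\<dots> \<le> q * (u n)\<^sup>2 + (d n)\<^sup>2 / (1 - q)"
    proof -
      \<comment> \<open>The defect in the convexity inequality is an explicit square.\<close>
      have "0 \<le> q / (1 - q) * ((1 - q) * u n - d n)\<^sup>2" using q by auto
      also have "\<dots> = q * (u n)\<^sup>2 + (d n)\<^sup>2 / (1 - q) - (q * u n + d n)\<^sup>2"
        using q by (simp add: divide_simps) (simp add: algebra_simps power2_eq_square)
      finally show ?thesis by simp
    qed
    finally show ?thesis by (simp add: algebra_simps)
  qed
  have "(u (N + 1))\<^sup>2 + (1 - q) * (\<Sum>n=1..N. (u n)\<^sup>2) \<le> (\<Sum>n=1..N. (d n)\<^sup>2) / (1 - q)" for N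
  proof (induction N)
    case 0
    show ?case using u(2) by simp
  next
    case (Suc N)
    then show ?case using sq[of "Suc N"] by (simp add: algebra_simps add_divide_distrib)
  qed
  then have "(1 - q) * (\<Sum>n=1..N. (u n)\<^sup>2) \<le> (\<Sum>n=1..N. (d n)\<^sup>2) / (1 - q)"
    by (smt (verit) zero_le_power2)
  then have "(\<Sum>n=1..N. (u n)\<^sup>2) * (1 - q)\<^sup>2 \<le> (\<Sum>n=1..N. (d n)\<^sup>2)"
    using q by (simp add: pos_le_divide_eq power2_eq_square mult_ac)
  then show ?thesis using q by (simp add: pos_le_divide_eq)
qed

locale aammsu_pos = aammsu \<mu> M \<nu> \<epsilon> \<beta>2 \<eta> \<gamma>t g
  for \<mu> M \<nu> \<epsilon> \<beta>2 :: real
    and \<eta> :: "nat \<Rightarrow> real"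
    and \<gamma>t :: "nat \<Rightarrow> real ^ 'd"
    and g :: "nat \<Rightarrow> real ^ 'd" +
  assumes mu_pos: "0 < \<mu>" and mu_less: "\<mu> < 1" and M_pos: "0 < M" and nu_pos: "0 < \<nu>"
    and eps_pos: "0 < \<epsilon>" and beta2_pos: "0 < \<beta>2" and beta2_less: "\<beta>2 < 1"
    and eta_pos: "n \<ge> 1 \<Longrightarrow> 0 < \<eta> n"
begin

lemma vmax_nonneg: "0 \<le> vmax n $ i"
  by (induction n) (auto simp: le_max_iff_disj)

lemma a_pos: "n \<ge> 1 \<Longrightarrow> 0 < a n $ i"
  using eta_pos[of n] eps_pos vmax_nonneg[of n i] by (auto simp: a_def intro!: divide_pos_pos add_pos_nonneg)

text \<open>
  The momentum form and 2SAGM describe the same iterates. In 2SAGM the last displacement of \<open>\<theta>\<close> and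
  the last gradient determine \<open>w n - \<theta> n\<close> (equation \<open>w_eq\<close> below), so \<open>w\<close> can be eliminated;
  \<open>p n\<close> is minus that displacement divided by \<open>r (n - 1)\<close>. Positivity of \<open>r\<close> makes this division
  harmless, and \<open>w_eq\<close> needs \<open>mu n = \<mu>\<close>, that is \<open>n \<ge> 2\<close>, which is why the recursion starts at 3.
\<close>

lemma two_sagm_of_is_aammsu:
  assumes "is_aammsu \<theta>1 w1 \<theta> p z w"
  obtains y where "two_sagm \<theta>1 w1 \<theta> w z y"
proof -
  from assms obtain \<theta>' z' y' where run: "two_sagm \<theta>1 w1 \<theta>' w z' y'"
    and \<theta>: "\<theta> 1 = \<theta>' 1" "\<theta> 2 = \<theta>' 2" "\<theta> 3 = \<theta>' 3" and z: "z 1 = z' 1" "z 2 = z' 2"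
    and p3: "p 3 = - ((\<theta> 3 - \<theta> 2) \<oslash> r 2)"
    and rec: "\<And>n. n \<ge> 3 \<Longrightarrow> z n = \<theta> n - gam n * r (n - 1) * p n - \<gamma>t n * omega n * g (n - 1)"
      "\<And>n. n \<ge> 3 \<Longrightarrow> p (n + 1) = tau n * p n + \<nu> *\<^sub>R g n - k n * g (n - 1)"
      "\<And>n. n \<ge> 3 \<Longrightarrow> \<theta> (n + 1) = \<theta> n - r n * p (n + 1)"
    unfolding is_aammsu_def by blast
  have z': "z' n $ i = (1 - \<gamma>t n $ i) * \<theta>' n $ i + \<gamma>t n $ i * w n $ i"
    and y': "y' n $ i = (1 - mu n) * \<theta>' n $ i + mu n * w n $ i"
    and w': "w (n + 1) $ i = w n $ i - M * alpha n $ i * g n $ i"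
    and \<theta>': "\<theta>' (n + 1) $ i = y' n $ i - alpha n $ i * g n $ i" if "n \<ge> 1" for n i
    using run that by (simp_all add: two_sagm_def lam_def)
  have r_pos: "0 < r n $ i" if "n \<ge> 1" for n i
    using a_pos[OF that] by (simp add: r_def)
  have alpha_r: "alpha n $ i = \<nu> * r n $ i" for n i
    by (simp add: alpha_def r_def)
  have w_eq: "\<mu> * (w (n + 1) $ i - \<theta>' (n + 1) $ i)
      = (1 - \<mu>) * (\<theta>' (n + 1) $ i - \<theta>' n $ i) - \<mu> * (M - 1 / \<mu>) * alpha n $ i * g n $ i"
    if "n \<ge> 2" for n i
  proof -
    have "\<mu> * (M - 1 / \<mu>) = \<mu> * M - 1" using mu_pos by (simp add: right_diff_distrib)
    moreover have "\<theta>' (n + 1) $ i = (1 - \<mu>) * \<theta>' n $ i + \<mu> * w n $ i - alpha n $ i * g n $ i"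
      using y'[of n i] \<theta>'[of n i] that by (simp add: mu_def)
    ultimately show ?thesis
      using w'[of n i] that by (simp only: ) (simp add: algebra_simps)
  qed
  have eqs: "\<theta> n = \<theta>' n \<and> r (n - 1) * p n = \<theta>' (n - 1) - \<theta>' n \<and> z n = z' n" if "n \<ge> 3" for n
    using that
  proof (induction n rule: dec_induct)
    \<comment> \<open>The agreement of \<open>z\<close> at \<open>n\<close> follows from that of \<open>\<theta>\<close> and \<open>p\<close> at \<open>n\<close> alone.\<close>
    have z_eq: "z n = z' n"
      if "n \<ge> 3" "\<theta> n = \<theta>' n" "r (n - 1) * p n = \<theta>' (n - 1) - \<theta>' n" for n
    proof -
      have "z n $ i = z' n $ i" for i
      proof -
        obtain m where m: "n = m + 1" "m \<ge> 2" using \<open>n \<ge> 3\<close> by (cases n) auto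
        have rp: "r m $ i * p n $ i = \<theta>' m $ i - \<theta>' n $ i"
          using that(3) m by (metis add_diff_cancel_right' vector_mult_component vector_minus_component)
        have "z n $ i = \<theta>' n $ i - (1 - \<mu>) / \<mu> * \<gamma>t n $ i * (r m $ i * p n $ i)
            - \<gamma>t n $ i * ((M - 1 / \<mu>) * alpha m $ i) * g m $ i"
          unfolding rec(1)[OF \<open>n \<ge> 3\<close>] using m that(2)
          by (simp add: gam_def omega_def mu_def lam_def algebra_simps)
        also have "\<dots> = \<theta>' n $ i + \<gamma>t n $ i / \<mu> * ((1 - \<mu>) * (\<theta>' n $ i - \<theta>' m $ i)
             - \<mu> * (M - 1 / \<mu>) * alpha m $ i * g m $ i)"
          unfolding rp using mu_pos by (simp add: field_simps)
        also have "\<dots> = \<theta>' n $ i + \<gamma>t n $ i / \<mu> * (\<mu> * (w n $ i - \<theta>' n $ i))"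
          using w_eq[OF m(2), of i] m(1) by simp
        also have "\<dots> = z' n $ i"
          using z'[of n i] m mu_pos by (simp add: algebra_simps)
        finally show ?thesis .
      qed
      then show ?thesis by (simp add: vec_eq_iff)
    qed
    {
      case base
      have "r 2 * p 3 = \<theta>' 2 - \<theta>' 3"
        using r_pos[of 2] by (simp add: p3 \<theta> vec_div_def vec_eq_iff less_imp_neq[THEN not_sym])
      then show ?case using z_eq[of 3] \<theta> by simp
    next
      case (step n)
      obtain m where m: "n = m + 1" "m \<ge> 2" using step(1) by (cases n) auto
      have rp: "r n $ i * p (n + 1) $ i = \<theta>' n $ i - \<theta>' (n + 1) $ i" for i
      proof -
        have rpm: "r m $ i * p n $ i = \<theta>' m $ i - \<theta>' n $ i"
          using step(3) m by (metis add_diff_cancel_right' vector_mult_component vector_minus_component)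
        have "r n $ i * p (n + 1) $ i = (1 - \<mu>) * (r m $ i * p n $ i) + alpha n $ i * g n $ i
            + \<mu> * (M - 1 / \<mu>) * alpha m $ i * g m $ i"
        proof -
          have "n - 1 = m" "n \<noteq> 1" "m \<noteq> 1" using m by auto
          then show ?thesis
            unfolding rec(2)[OF step(1)] using r_pos[of n i] mu_pos step(1)
            by (simp add: tau_def beta_def k_def mu_def vec_div_def omega_def lam_def alpha_r[of n]
                 field_simps)
        qed
        also have "\<dots> = alpha n $ i * g n $ i - \<mu> * (w n $ i - \<theta>' n $ i)"
          unfolding rpm w_eq[OF m(2), of i, folded m(1)] by (simp add: algebra_simps)
        also have "\<dots> = \<theta>' n $ i - \<theta>' (n + 1) $ i"
          using \<theta>'[of n i] y'[of n i] step(1) by (simp add: mu_def algebra_simps)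
        finally show ?thesis .
      qed
      have "r n * p (n + 1) = \<theta>' n - \<theta>' (n + 1)" using rp by (simp add: vec_eq_iff)
      moreover from this have "\<theta> (n + 1) = \<theta>' (n + 1)"
        using rec(3)[OF step(1)] step(3) by simp
      ultimately show ?case using z_eq[of "n + 1"] step(1) by simp
    }
  qed
  have "\<theta> n = \<theta>' n \<and> z n = z' n" if "n \<ge> 1" for n
  proof -
    have "n = 1 \<or> n = 2 \<or> n \<ge> 3" using that by linarith
    then show ?thesis using eqs[of n] \<theta> z by auto
  qed
  then have "two_sagm \<theta>1 w1 \<theta> w z y'"
    using run by (simp add: two_sagm_def)
  then show ?thesis using that by blast
qed


lemma vtilde_le:
  assumes g: "\<And>n. n \<ge> 1 \<Longrightarrow> norm (g n) \<le> K"
  shows "vtilde n $ i \<le> K\<^sup>2"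
proof (induction n)
  case (Suc n)
  have "\<bar>g (Suc n) $ i\<bar> \<le> K"
    using component_le_norm_cart[of "g (Suc n)" i] g[of "Suc n"] by simp
  then have "g (Suc n) $ i * g (Suc n) $ i \<le> K\<^sup>2"
    by (metis abs_le_square_iff abs_of_nonneg abs_ge_zero order.trans power2_eq_square)
  then have "\<beta>2 * vtilde n $ i + (1 - \<beta>2) * (g (Suc n) $ i * g (Suc n) $ i) \<le> \<beta>2 * K\<^sup>2 + (1 - \<beta>2) * K\<^sup>2"
    using Suc beta2_pos beta2_less by (intro add_mono mult_left_mono) auto
  then show ?case by (simp add: algebra_simps)
qed simp

lemma a_le: "n \<ge> 1 \<Longrightarrow> a n $ i \<le> \<eta> n / \<epsilon>"
  using eta_pos[of n] eps_pos vmax_nonneg[of n i] by (auto simp: a_def intro!: divide_left_mono mult_pos_pos add_pos_nonneg)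

lemma a_ge:
  assumes g: "\<And>n. n \<ge> 1 \<Longrightarrow> norm (g n) \<le> K" and n: "n \<ge> 1"
  shows "\<eta> n / (\<epsilon> + K) \<le> a n $ i"
proof -
  have K: "0 \<le> K" using g[of 1] norm_ge_zero[of "g 1"] by linarith
  have "vmax n $ i \<le> K\<^sup>2"
    by (induction n) (use vtilde_le[OF g] in \<open>auto simp del: vtilde.simps(2)\<close>)
  then have "sqrt (vmax n $ i) \<le> K" using K by (simp add: real_le_lsqrt)
  then show ?thesis
    using eta_pos[OF n] eps_pos vmax_nonneg[of n i] K
    by (auto simp: a_def intro!: divide_left_mono mult_pos_pos add_pos_nonneg)
qed

text \<open>
  The vector \<open>h n\<close> in the proof is \<open>w n - y n\<close>. Scaling \<open>w n - \<theta> n\<close> by \<open>1 - mu n\<close> makes the sequence start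
  at \<open>0\<close> whatever \<open>\<theta> 1\<close> is, and \<open>\<gamma>t 1 = 1\<close> gives \<open>z 1 = w 1\<close>, so the comparison of
  \<open>w n - z n\<close> with \<open>h n\<close> also holds at \<open>n = 1\<close>.
\<close>

lemma sum_dist_le:
  assumes run: "two_sagm \<theta>1 w1 \<theta> w z y"
    and \<gamma>1: "\<gamma>t 1 = 1" and \<gamma>: "\<And>n. n \<ge> 2 \<Longrightarrow> (norm (1 - \<gamma>t n))\<^sup>2 / (1 - \<mu>) \<le> B"
    and B: "0 \<le> B"
    and g: "\<And>n. n \<ge> 1 \<Longrightarrow> norm (g n) \<le> K"
  shows "(\<Sum>n=1..N. (norm (w n - z n))\<^sup>2)
    \<le> B * (1 - \<mu>) * ((M - 1) * \<nu> * K / (\<mu> * \<epsilon>))\<^sup>2 * (\<Sum>n=1..N. (\<eta> n)\<^sup>2)"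
proof -
  define h where "h n = (1 - mu n) *\<^sub>R (w n - \<theta> n)" for n
  define D where "D = (1 - \<mu>) * (\<bar>M - 1\<bar> * \<nu> * K / \<epsilon>)"
  have step: "norm (h (n + 1)) \<le> (1 - \<mu>) * norm (h n) + D * \<eta> n" if n: "n \<ge> 1" for n
  proof -
    have w: "w (n + 1) = w n - lam n * g n"
      and \<theta>: "\<theta> (n + 1) = (1 - mu n) *\<^sub>R \<theta> n + mu n *\<^sub>R w n - alpha n * g n"
      using run n by (auto simp: two_sagm_def)
    have "h (n + 1) = (1 - \<mu>) *\<^sub>R (h n - ((M - 1) *\<^sub>R alpha n) * g n)"
      unfolding h_def w \<theta> using n by (simp add: mu_def[of "Suc n"] lam_def vec_eq_iff algebra_simps)
    moreover have "norm (((M - 1) *\<^sub>R alpha n) * g n) \<le> (\<bar>M - 1\<bar> * \<nu> * \<eta> n / \<epsilon>) * norm (g n)"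
      using a_pos[OF n] a_le[OF n] nu_pos
      by (intro norm_mult_le_vec)
        (auto simp: alpha_def abs_mult less_imp_le abs_of_pos mult.assoc simp flip: times_divide_eq_right intro!: mult_left_mono)
    moreover have "\<dots> \<le> (\<bar>M - 1\<bar> * \<nu> * \<eta> n / \<epsilon>) * K"
      using g[OF n] nu_pos eps_pos eta_pos[OF n] by (intro mult_left_mono) auto
    ultimately have "norm (h (n + 1)) \<le> (1 - \<mu>) * (norm (h n) + (\<bar>M - 1\<bar> * \<nu> * \<eta> n / \<epsilon>) * K)"
      using mu_less norm_triangle_ineq4[of "h n" "((M - 1) *\<^sub>R alpha n) * g n"]
      by (auto intro!: mult_left_mono)
    then show ?thesis by (simp add: D_def algebra_simps)
  qed
  have wz: "(norm (w n - z n))\<^sup>2 \<le> B / (1 - \<mu>) * (norm (h n))\<^sup>2" if n: "n \<ge> 1" for n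
  proof (cases "n = 1")
    case True
    then show ?thesis using run \<gamma>1 by (simp add: two_sagm_def h_def mu_def)
  next
    case False
    then have n2: "n \<ge> 2" using n by simp
    have "w n - z n = (1 - \<gamma>t n) * (w n - \<theta> n)"
      using run n unfolding two_sagm_def by (simp add: vec_eq_iff algebra_simps)
    then have "norm (w n - z n) \<le> norm (1 - \<gamma>t n) * norm (w n - \<theta> n)"
      by (simp add: norm_mult_le_vec component_le_norm_cart del: vector_minus_component one_index)
    then have "(norm (w n - z n))\<^sup>2 \<le> (norm (1 - \<gamma>t n))\<^sup>2 * (norm (w n - \<theta> n))\<^sup>2"
      by (metis norm_ge_zero power_mono power_mult_distrib)
    also have "\<dots> \<le> (B * (1 - \<mu>)) * (norm (w n - \<theta> n))\<^sup>2"
      using \<gamma>[OF n2] mu_less by (intro mult_right_mono) (auto simp: pos_divide_le_eq)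
    also have "\<dots> = B / (1 - \<mu>) * (norm (h n))\<^sup>2"
      using mu_less n2 by (simp add: h_def mu_def power2_eq_square)
    finally show ?thesis .
  qed
  have "(\<Sum>n=1..N. (norm (w n - z n))\<^sup>2) \<le> B / (1 - \<mu>) * (\<Sum>n=1..N. (norm (h n))\<^sup>2)"
    unfolding sum_distrib_left by (intro sum_mono wz) auto
  also have "\<dots> \<le> B / (1 - \<mu>) * ((\<Sum>n=1..N. (D * \<eta> n)\<^sup>2) / (1 - (1 - \<mu>))\<^sup>2)"
    using mu_pos mu_less B step
    by (intro mult_left_mono sum_power2_contraction_le) (auto simp: h_def mu_def)
  also have "\<dots> = B * (1 - \<mu>) * ((M - 1) * \<nu> * K / (\<mu> * \<epsilon>))\<^sup>2 * (\<Sum>n=1..N. (\<eta> n)\<^sup>2)"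
  proof -
    have "(\<Sum>n=1..N. (D * \<eta> n)\<^sup>2) = D\<^sup>2 * (\<Sum>n=1..N. (\<eta> n)\<^sup>2)"
      by (simp add: power_mult_distrib sum_distrib_left)
    moreover have "D\<^sup>2 = (1 - \<mu>) * (1 - \<mu>) * (\<mu>\<^sup>2 * ((M - 1) * \<nu> * K / (\<mu> * \<epsilon>))\<^sup>2)"
      using mu_pos by (simp add: D_def power_mult_distrib power_divide power2_eq_square[of "1 - \<mu>"])
    ultimately show ?thesis using mu_pos mu_less by simp
  qed
  finally show ?thesis .
qed

end

text \<open>
  The coefficient of \<open>\<Sum>n\<le>N. (\<eta> n)\<^sup>2\<close> in the telescoped descent inequality: the first summand stems from the
  distances between \<open>w n\<close> and \<open>z n\<close>, the second from the lengths of the steps of \<open>w\<close>.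
\<close>

definition drift_const :: "real \<Rightarrow> real \<Rightarrow> real \<Rightarrow> real \<Rightarrow> real \<Rightarrow> real \<Rightarrow> real \<Rightarrow> real" where
  "drift_const L \<mu> M \<nu> \<epsilon> K B =
     L / 2 * (B * (1 - \<mu>) * ((M - 1) * \<nu> * K / (\<mu> * \<epsilon>))\<^sup>2) + L * (M * \<nu> * K / \<epsilon>)\<^sup>2"

lemma (in aammsu_pos) sum_inner_le:
  assumes smooth: "smooth_objective F G L F_inf"
    and run: "two_sagm \<theta>1 w1 \<theta> w z y"
    and \<gamma>1: "\<gamma>t 1 = 1" and \<gamma>: "\<And>n. n \<ge> 2 \<Longrightarrow> (norm (1 - \<gamma>t n))\<^sup>2 / (1 - \<mu>) \<le> B"
    and B: "0 \<le> B"
    and g: "\<And>n. n \<ge> 1 \<Longrightarrow> norm (g n) \<le> K"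
  shows "(\<Sum>n=1..N. inner (G (z n)) (lam n * g n))
    \<le> F w1 - F_inf + drift_const L \<mu> M \<nu> \<epsilon> K B * (\<Sum>n=1..N. (\<eta> n)\<^sup>2)"
proof -
  interpret smooth_objective F G L F_inf by (rule smooth)
  have lam_g: "(norm (lam n * g n))\<^sup>2 \<le> (M * \<nu> * K / \<epsilon>)\<^sup>2 * (\<eta> n)\<^sup>2" if n: "n \<ge> 1" for n
  proof -
    have "norm (lam n * g n) \<le> (M * \<nu> * (\<eta> n / \<epsilon>)) * norm (g n)"
      using a_pos[OF n] a_le[OF n] nu_pos M_pos
      by (intro norm_mult_le_vec)
        (auto simp: lam_def alpha_def abs_mult less_imp_le abs_of_pos mult.assoc intro!: mult_left_mono simp del: times_divide_eq_right)
    also have "\<dots> \<le> (M * \<nu> * (\<eta> n / \<epsilon>)) * K"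
      using g[OF n] nu_pos M_pos eps_pos eta_pos[OF n] by (intro mult_left_mono) auto
    also have "\<dots> = (M * \<nu> * K / \<epsilon>) * \<eta> n" by simp
    finally show ?thesis by (metis norm_ge_zero power_mono power_mult_distrib)
  qed
  have step: "inner (G (z n)) (lam n * g n) \<le> F (w n) - F (w (n + 1))
      + L / 2 * (norm (w n - z n))\<^sup>2 + L * (M * \<nu> * K / \<epsilon>)\<^sup>2 * (\<eta> n)\<^sup>2" if n: "n \<ge> 1" for n
  proof -
    have "w (n + 1) = w n + - (lam n * g n)" using run n by (simp add: two_sagm_def)
    then have "F (w (n + 1)) \<le> F (w n) - inner (G (z n)) (lam n * g n)
        + L / 2 * (norm (w n - z n))\<^sup>2 + L * (norm (lam n * g n))\<^sup>2"
      using descent_shifted[of "w n" "- (lam n * g n)" "z n"] by simp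
    moreover have "L * (norm (lam n * g n))\<^sup>2 \<le> L * (M * \<nu> * K / \<epsilon>)\<^sup>2 * (\<eta> n)\<^sup>2"
      using mult_left_mono[OF lam_g[OF n], of L] L_pos by simp
    ultimately show ?thesis by linarith
  qed
  have "(\<Sum>n=1..N. inner (G (z n)) (lam n * g n)) \<le> F (w 1) - F (w (N + 1))
      + L / 2 * (\<Sum>n=1..N. (norm (w n - z n))\<^sup>2) + L * (M * \<nu> * K / \<epsilon>)\<^sup>2 * (\<Sum>n=1..N. (\<eta> n)\<^sup>2)"
  proof (induction N)
    case (Suc N)
    then show ?case using step[of "Suc N"] by (simp add: distrib_left)
  qed simp
  also have "\<dots> \<le> F w1 - F_inf
      + L / 2 * (B * (1 - \<mu>) * ((M - 1) * \<nu> * K / (\<mu> * \<epsilon>))\<^sup>2 * (\<Sum>n=1..N. (\<eta> n)\<^sup>2))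
      + L * (M * \<nu> * K / \<epsilon>)\<^sup>2 * (\<Sum>n=1..N. (\<eta> n)\<^sup>2)"
    using run lower_bound L_pos
    by (intro add_mono diff_mono mult_left_mono sum_dist_le[OF run \<gamma>1 \<gamma> B g])
      (auto simp: two_sagm_def)
  finally show ?thesis by (simp add: drift_const_def distrib_right)
qed

section \<open>Expectations\<close>

locale stochastic_smooth_aammsu =
  stochastic_aammsu P G L \<mu> M \<nu> \<epsilon> \<beta>2 \<sigma> K B \<theta>1 w1 N \<eta> \<gamma>t Fl g \<theta> p z w +
  smooth_objective F G L F_inf
  for P :: "'w measure"
    and F :: "real ^ 'd \<Rightarrow> real" and G :: "real ^ 'd \<Rightarrow> real ^ 'd"
    and L F_inf \<mu> M \<nu> \<epsilon> \<beta>2 \<sigma> K B :: real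
    and \<theta>1 w1 :: "'w \<Rightarrow> real ^ 'd"
    and N :: nat
    and \<eta> :: "nat \<Rightarrow> real"
    and \<gamma>t :: "nat \<Rightarrow> 'w \<Rightarrow> real ^ 'd"
    and Fl :: "nat \<Rightarrow> 'w measure"
    and g \<theta> p z w :: "nat \<Rightarrow> 'w \<Rightarrow> real ^ 'd" +
  assumes mu: "0 < \<mu>" "\<mu> < 1" and M: "0 < M" and nu: "0 < \<nu>" and eps: "0 < \<epsilon>"
    and beta2: "0 < \<beta>2" "\<beta>2 < 1" and K: "0 < K"
    and F_initial: "integrable P (\<lambda>\<omega>. F (w1 \<omega>))"
begin

abbreviation lam :: "nat \<Rightarrow> 'w \<Rightarrow> real ^ 'd"
  where "lam n \<omega> \<equiv> aammsu.lam M \<nu> \<epsilon> \<beta>2 \<eta> (\<lambda>n. g n \<omega>) n"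

lemma aammsu_pos: "aammsu_pos \<mu> M \<nu> \<epsilon> \<beta>2 \<eta>"
  using mu M nu eps beta2 eta_pos by unfold_locales

lemma lam_bounds:
  assumes n: "n \<ge> 1"
  shows "0 \<le> lam n \<omega> $ i" "lam n \<omega> $ i \<le> M * \<nu> * (\<eta> n / \<epsilon>)"
proof -
  interpret T: aammsu_pos \<mu> M \<nu> \<epsilon> \<beta>2 \<eta> "\<lambda>n. \<gamma>t n \<omega>" "\<lambda>n. g n \<omega>" by (rule aammsu_pos)
  show "0 \<le> lam n \<omega> $ i" "lam n \<omega> $ i \<le> M * \<nu> * (\<eta> n / \<epsilon>)"
    using T.a_pos[OF n, of i] T.a_le[OF n, of i] M nu
    by (auto simp: T.lam_def T.alpha_def less_imp_le mult.assoc simp del: times_divide_eq_right)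
qed

lemma lam_ge:
  assumes "\<And>n. n \<ge> 1 \<Longrightarrow> norm (g n \<omega>) \<le> K" and n: "n \<ge> 1"
  shows "M * \<nu> / (\<epsilon> + K) * \<eta> n \<le> lam n \<omega> $ i"
proof -
  interpret T: aammsu_pos \<mu> M \<nu> \<epsilon> \<beta>2 \<eta> "\<lambda>n. \<gamma>t n \<omega>" "\<lambda>n. g n \<omega>" by (rule aammsu_pos)
  have "M * (\<nu> * (\<eta> n / (\<epsilon> + K))) \<le> lam n \<omega> $ i"
    using T.a_ge[OF assms, of i] M nu by (simp add: T.lam_def T.alpha_def del: times_divide_eq_right)
  then show ?thesis by simp
qed

lemma AE_g_bound: "AE \<omega> in P. \<forall>n\<ge>1. norm (g n \<omega>) \<le> K"
  using g_bound by (simp add: AE_all_countable)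

lemma AE_gamma_B: "AE \<omega> in P. \<forall>n\<ge>2. (norm (1 - \<gamma>t n \<omega>))\<^sup>2 / (1 - \<mu>) \<le> B"
  using gamma_B by (simp add: AE_all_countable)

text \<open>
  \<open>B\<close> is only given as an almost sure bound; on a probability space there is a point at which the
  bound holds.
\<close>

lemma B_nonneg: "0 \<le> B"
proof -
  have "AE \<omega> in P. 0 \<le> B"
    using gamma_B[OF order_refl]
  proof eventually_elim
    case (elim \<omega>)
    have "0 \<le> (norm (1 - \<gamma>t 2 \<omega>))\<^sup>2 / (1 - \<mu>)" using mu by simp
    then show ?case using elim by linarith
  qed
  then show ?thesis by simp
qed

lemma G_measurable [measurable]: "G \<in> borel_measurable borel"
proof -
  have "L-lipschitz_on UNIV G"
    using lipschitz L_pos by (intro lipschitz_onI) (auto simp: dist_norm)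
  then show ?thesis
    by (intro borel_measurable_continuous_onI lipschitz_on_continuous_on)
qed

lemma vec_nth_measurable [measurable]:
  "f \<in> borel_measurable A \<Longrightarrow> (\<lambda>x. f x $ (i :: 'd)) \<in> borel_measurable A"
  by (rule borel_measurable_continuous_on[where f = "\<lambda>v. v $ i"]) (intro continuous_intros)

lemma process_measurable [measurable]:
  assumes "n \<ge> 1"
  shows "g n \<in> borel_measurable P" "z n \<in> borel_measurable P" "lam n \<in> borel_measurable P"
  using g_measurable[OF assms] z_measurable[OF assms] lam_measurable[OF assms]
    measurable_from_subalg[OF sub_sigma[OF assms]] by auto

text \<open>
  The true gradients inherit the bound on the noisy ones, being their conditional expectations. This
  makes \<open>G (z n)\<close> square integrable and the products with \<open>g n\<close> integrable.
\<close>

lemma AE_gradient_le: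
  assumes n: "n \<ge> 1"
  shows "AE \<omega> in P. \<forall>i. \<bar>G (z n \<omega>) $ i\<bar> \<le> K"
proof -
  interpret finite_measure_subalgebra P "Fl n" by unfold_locales (rule sub_sigma[OF n])
  have "AE \<omega> in P. \<bar>G (z n \<omega>) $ i\<bar> \<le> K" for i
  proof -
    have b: "AE \<omega> in P. \<bar>g n \<omega> $ i\<bar> \<le> K"
      using g_bound[OF n] by eventually_elim (rule order.trans[OF component_le_norm_cart])
    have "integrable P (\<lambda>\<omega>. g n \<omega> $ i)"
      using b by (intro integrable_const_bound[where B = K]) (use n in measurable)
    then have "AE \<omega> in P. real_cond_exp P (Fl n) (\<lambda>\<omega>. g n \<omega> $ i) \<omega> \<le> K"
      "AE \<omega> in P. real_cond_exp P (Fl n) (\<lambda>\<omega>. g n \<omega> $ i) \<omega> \<ge> - K"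
      using b by (intro real_cond_exp_le_c real_cond_exp_ge_c; force)+
    then show ?thesis using unbiased[OF n, of i] by eventually_elim auto
  qed
  then show ?thesis by (simp add: AE_all_countable)
qed

lemma integrable_gradient:
  assumes n: "n \<ge> 1"
  shows "integrable P (\<lambda>\<omega>. (norm (G (z n \<omega>)))\<^sup>2)"
proof (rule integrable_const_bound)
  show "AE \<omega> in P. norm ((norm (G (z n \<omega>)))\<^sup>2) \<le> (\<Sum>i\<in>(UNIV::'d set). K)\<^sup>2"
    using AE_gradient_le[OF n]
  proof eventually_elim
    case (elim \<omega>)
    then have "norm (G (z n \<omega>)) \<le> (\<Sum>i\<in>(UNIV::'d set). K)"
      by (intro order.trans[OF norm_le_l1_cart] sum_mono) auto
    then show ?case by (simp add: power_mono)
  qed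
qed (use n in measurable)

text \<open>
  Componentwise, the weight \<open>X i\<close> in front of \<open>g n $ i\<close> is \<open>Fl n\<close>-measurable, so under the integral
  \<open>g n $ i\<close> may be exchanged for \<open>G (z n) $ i\<close>. The resulting integrand is a nonnegative combination of
  squares, to which the lower bound on the stepsizes applies.
\<close>

lemma expectation_inner_ge:
  assumes n: "n \<ge> 1"
  shows "integrable P (\<lambda>\<omega>. inner (G (z n \<omega>)) (lam n \<omega> * g n \<omega>))"
    and "M * \<nu> / (\<epsilon> + K) * \<eta> n * (\<integral>\<omega>. (norm (G (z n \<omega>)))\<^sup>2 \<partial>P)
      \<le> (\<integral>\<omega>. inner (G (z n \<omega>)) (lam n \<omega> * g n \<omega>) \<partial>P)"
proof -
  interpret finite_measure_subalgebra P "Fl n" by unfold_locales (rule sub_sigma[OF n])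
  have meas [measurable]: "lam n \<in> borel_measurable (Fl n)" "z n \<in> borel_measurable (Fl n)"
    using lam_measurable[OF n] z_measurable[OF n] by auto
  note [measurable] = process_measurable[OF n]
  define X where "X i \<omega> = lam n \<omega> $ i * G (z n \<omega>) $ i" for i \<omega>
  have X_meas [measurable]: "X i \<in> borel_measurable (Fl n)" "X i \<in> borel_measurable P" for i
    unfolding X_def[abs_def] by measurable
  have int: "integrable P (\<lambda>\<omega>. X i \<omega> * g n \<omega> $ i)" for i
  proof (rule integrable_const_bound)
    show "AE \<omega> in P. norm (X i \<omega> * g n \<omega> $ i) \<le> (M * \<nu> * (\<eta> n / \<epsilon>)) * K * K"
      using AE_gradient_le[OF n] g_bound[OF n]
    proof eventually_elim
      case (elim \<omega>)
      have "\<bar>g n \<omega> $ i\<bar> \<le> K" using elim(2) component_le_norm_cart[of "g n \<omega>" i] by linarith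
      moreover have "\<bar>lam n \<omega> $ i\<bar> \<le> M * \<nu> * (\<eta> n / \<epsilon>)" using lam_bounds[OF n, of \<omega> i] by simp
      ultimately show ?case
        using elim(1) by (auto simp: X_def abs_mult simp del: times_divide_eq_right intro!: mult_mono)
    qed
  qed measurable
  have cond: "integrable P (\<lambda>\<omega>. X i \<omega> * G (z n \<omega>) $ i)"
    "(\<integral>\<omega>. X i \<omega> * G (z n \<omega>) $ i \<partial>P) = (\<integral>\<omega>. X i \<omega> * g n \<omega> $ i \<partial>P)" for i
  proof -
    have ae: "AE \<omega> in P. X i \<omega> * real_cond_exp P (Fl n) (\<lambda>\<omega>. g n \<omega> $ i) \<omega> = X i \<omega> * G (z n \<omega>) $ i"
      using unbiased[OF n, of i] by eventually_elim simp
    note R = real_cond_exp_intg[OF int[of i] X_meas(1)]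
    show "integrable P (\<lambda>\<omega>. X i \<omega> * G (z n \<omega>) $ i)"
      by (rule integrable_cong_AE_imp[OF R(1)]) (use ae in auto)
    show "(\<integral>\<omega>. X i \<omega> * G (z n \<omega>) $ i \<partial>P) = (\<integral>\<omega>. X i \<omega> * g n \<omega> $ i \<partial>P)"
      using R(2) integral_cong_AE[OF _ _ ae] by simp
  qed
  have inner_eq: "inner (G (z n \<omega>)) (lam n \<omega> * g n \<omega>) = (\<Sum>i\<in>UNIV. X i \<omega> * g n \<omega> $ i)" for \<omega>
    by (simp add: inner_vec_def X_def mult_ac)
  show "integrable P (\<lambda>\<omega>. inner (G (z n \<omega>)) (lam n \<omega> * g n \<omega>))"
    unfolding inner_eq using int by auto
  have "M * \<nu> / (\<epsilon> + K) * \<eta> n * (\<integral>\<omega>. (norm (G (z n \<omega>)))\<^sup>2 \<partial>P)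
      = (\<integral>\<omega>. M * \<nu> / (\<epsilon> + K) * \<eta> n * (norm (G (z n \<omega>)))\<^sup>2 \<partial>P)"
    by (rule integral_mult_right_zero[symmetric])
  also have "\<dots> \<le> (\<integral>\<omega>. (\<Sum>i\<in>UNIV. X i \<omega> * G (z n \<omega>) $ i) \<partial>P)"
  proof (rule integral_mono_AE)
    show "AE \<omega> in P. M * \<nu> / (\<epsilon> + K) * \<eta> n * (norm (G (z n \<omega>)))\<^sup>2 \<le> (\<Sum>i\<in>UNIV. X i \<omega> * G (z n \<omega>) $ i)"
      using AE_g_bound
    proof eventually_elim
      case (elim \<omega>)
      have "M * \<nu> / (\<epsilon> + K) * \<eta> n * (norm (G (z n \<omega>)))\<^sup>2
          = (\<Sum>i\<in>UNIV. M * \<nu> / (\<epsilon> + K) * \<eta> n * (G (z n \<omega>) $ i)\<^sup>2)"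
        unfolding power2_norm_eq_inner by (simp add: inner_vec_def sum_distrib_left power2_eq_square)
      also have "\<dots> \<le> (\<Sum>i\<in>UNIV. lam n \<omega> $ i * (G (z n \<omega>) $ i)\<^sup>2)"
        using elim n by (intro sum_mono mult_right_mono lam_ge) auto
      finally show ?case by (simp add: X_def power2_eq_square mult_ac)
    qed
  qed (use cond integrable_gradient[OF n] in auto)
  also have "\<dots> = (\<integral>\<omega>. inner (G (z n \<omega>)) (lam n \<omega> * g n \<omega>) \<partial>P)"
    unfolding inner_eq using cond int by (simp add: Bochner_Integration.integral_sum)
  finally show "M * \<nu> / (\<epsilon> + K) * \<eta> n * (\<integral>\<omega>. (norm (G (z n \<omega>)))\<^sup>2 \<partial>P)
      \<le> (\<integral>\<omega>. inner (G (z n \<omega>)) (lam n \<omega> * g n \<omega>) \<partial>P)" .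
qed

lemma integrable_min:
  assumes "n \<ge> 1"
  shows "integrable P (\<lambda>\<omega>. MIN k\<in>{1..n}. (norm (G (z k \<omega>)))\<^sup>2)"
proof (rule Bochner_Integration.integrable_bound[OF integrable_gradient[of 1]])
  show "AE \<omega> in P. norm (MIN k\<in>{1..n}. (norm (G (z k \<omega>)))\<^sup>2) \<le> norm ((norm (G (z 1 \<omega>)))\<^sup>2)"
  proof (rule AE_I2)
    fix \<omega>
    have "0 \<le> (MIN k\<in>{1..n}. (norm (G (z k \<omega>)))\<^sup>2)"
      using assms by (intro Min.boundedI) auto
    then show "norm (MIN k\<in>{1..n}. (norm (G (z k \<omega>)))\<^sup>2) \<le> norm ((norm (G (z 1 \<omega>)))\<^sup>2)"
      using assms by (auto intro!: Min_le)
  qed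
qed auto

text \<open>
  The minimum is below every term, hence below the average with weights \<open>\<eta> n\<close>; the latter is
  controlled by the expectation of the telescoped trajectory inequality \<open>sum_inner_le\<close>.
\<close>

theorem expectation_min_le:
  assumes N: "N \<ge> 1"
  shows "M * \<nu> / (\<epsilon> + K) * (\<Sum>n=1..N. \<eta> n) * (\<integral>\<omega>. (MIN n\<in>{1..N}. (norm (G (z n \<omega>)))\<^sup>2) \<partial>P)
    \<le> (\<integral>\<omega>. F (w1 \<omega>) \<partial>P) - F_inf + drift_const L \<mu> M \<nu> \<epsilon> K B * (\<Sum>n=1..N. (\<eta> n)\<^sup>2)"
proof -
  let ?m = "\<integral>\<omega>. (MIN n\<in>{1..N}. (norm (G (z n \<omega>)))\<^sup>2) \<partial>P"
  have "?m \<le> (\<integral>\<omega>. (norm (G (z n \<omega>)))\<^sup>2 \<partial>P)" if "n \<in> {1..N}" for n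
    using that N by (intro integral_mono integrable_min integrable_gradient) auto
  then have "M * \<nu> / (\<epsilon> + K) * (\<Sum>n=1..N. \<eta> n) * ?m
      \<le> (\<Sum>n=1..N. M * \<nu> / (\<epsilon> + K) * \<eta> n * (\<integral>\<omega>. (norm (G (z n \<omega>)))\<^sup>2 \<partial>P))"
    unfolding sum_distrib_left sum_distrib_right
    using M nu eps K eta_pos by (intro sum_mono mult_left_mono) (auto simp: less_imp_le)
  also have "\<dots> \<le> (\<Sum>n=1..N. \<integral>\<omega>. inner (G (z n \<omega>)) (lam n \<omega> * g n \<omega>) \<partial>P)"
    by (intro sum_mono expectation_inner_ge) auto
  also have "\<dots> = (\<integral>\<omega>. (\<Sum>n=1..N. inner (G (z n \<omega>)) (lam n \<omega> * g n \<omega>)) \<partial>P)"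
    using expectation_inner_ge(1) by (intro Bochner_Integration.integral_sum[symmetric]) auto
  also have "\<dots> \<le> (\<integral>\<omega>. F (w1 \<omega>) - F_inf + drift_const L \<mu> M \<nu> \<epsilon> K B * (\<Sum>n=1..N. (\<eta> n)\<^sup>2) \<partial>P)"
  proof (rule integral_mono_AE)
    show "AE \<omega> in P. (\<Sum>n=1..N. inner (G (z n \<omega>)) (lam n \<omega> * g n \<omega>))
        \<le> F (w1 \<omega>) - F_inf + drift_const L \<mu> M \<nu> \<epsilon> K B * (\<Sum>n=1..N. (\<eta> n)\<^sup>2)"
      using AE_g_bound AE_gamma_B AE_space
    proof eventually_elim
      case (elim \<omega>)
      interpret T: aammsu_pos \<mu> M \<nu> \<epsilon> \<beta>2 \<eta> "\<lambda>n. \<gamma>t n \<omega>" "\<lambda>n. g n \<omega>" by (rule aammsu_pos)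
      obtain y where "T.two_sagm (\<theta>1 \<omega>) (w1 \<omega>) (\<lambda>n. \<theta> n \<omega>) (\<lambda>n. w n \<omega>) (\<lambda>n. z n \<omega>) y"
        using T.two_sagm_of_is_aammsu[OF algorithm[OF elim(3)]] .
      from T.sum_inner_le[OF smooth_objective_axioms this gamma_one[OF elim(3)] _ B_nonneg]
      show ?case using elim by simp
    qed
  qed (use expectation_inner_ge(1) F_initial in auto)
  also have "\<dots> = (\<integral>\<omega>. F (w1 \<omega>) \<partial>P) - F_inf + drift_const L \<mu> M \<nu> \<epsilon> K B * (\<Sum>n=1..N. (\<eta> n)\<^sup>2)"
    using F_initial by (simp add: prob_space)
  finally show ?thesis .
qed

end

section \<open>Rates\<close>

lemma sum_inverse_le_ln:
  assumes "N \<ge> 2"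
  shows "(\<Sum>n=1..N. 1 / real n) \<le> (1 / ln 2 + 1) * ln (real N)"
proof -
  have "harm N - ln (real N) \<le> harm 1 - ln (real 1)"
    using euler_mascheroni_sequence_decreasing[of 1 N] assms by simp
  then have "(\<Sum>n=1..N. 1 / real n) \<le> 1 + ln (real N)"
    by (simp add: harm_def inverse_eq_divide)
  moreover have "1 \<le> ln (real N) / ln 2" using assms by simp
  moreover have "(1 / ln 2 + 1) * ln (real N) = ln (real N) / ln 2 + ln (real N)"
    by (simp add: distrib_right)
  ultimately show ?thesis by linarith
qed

theorem corollary11:
  fixes F :: "real ^ 'd \<Rightarrow> real"
    and G :: "real ^ 'd \<Rightarrow> real ^ 'd"
    and L \<mu> M \<nu> \<epsilon> \<beta>2 \<sigma> K B C :: real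
    and P :: "'w measure"
    and \<theta>1 w1 :: "'w \<Rightarrow> real ^ 'd"
  assumes gradient: "\<And>x. GDERIV F x :> G x"
    and continuous: "continuous_on UNIV G"
    and below: "bdd_below (range F)"
    and L: "0 < L"
    and lipschitz: "\<And>x y. norm (G x - G y) \<le> L * norm (x - y)"
    and mu: "0 < \<mu>" "\<mu> < 1"
    and M: "0 < M" and nu: "0 < \<nu>" and eps: "0 < \<epsilon>"
    and beta2: "0 < \<beta>2" "\<beta>2 < 1"
    and sigma: "0 < \<sigma>" and K: "0 < K" and C: "0 < C"
    and prob: "prob_space P"
    and initial: "\<theta>1 \<in> borel_measurable P" "w1 \<in> borel_measurable P"
    and F_initial: "integrable P (\<lambda>\<omega>. F (w1 \<omega>))"
  shows
      "(\<exists>c. \<forall>N\<ge>1. \<forall>\<eta> \<gamma>t Fl g \<theta> p z w.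
         stochastic_aammsu P G L \<mu> M \<nu> \<epsilon> \<beta>2 \<sigma> K B \<theta>1 w1 N \<eta> \<gamma>t Fl g \<theta> p z w \<longrightarrow>
         (\<forall>n\<in>{1..N}. \<eta> n = C / sqrt (real N)) \<longrightarrow>
         integrable P (\<lambda>\<omega>. MIN n\<in>{1..N}. (norm (G (z n \<omega>)))\<^sup>2) \<and>
         (\<integral>\<omega>. (MIN n\<in>{1..N}. (norm (G (z n \<omega>)))\<^sup>2) \<partial>P) \<le> c * (1 / sqrt (real N))) \<and>
       (\<exists>c. \<forall>N\<ge>2. \<forall>\<eta> \<gamma>t Fl g \<theta> p z w.
         stochastic_aammsu P G L \<mu> M \<nu> \<epsilon> \<beta>2 \<sigma> K B \<theta>1 w1 N \<eta> \<gamma>t Fl g \<theta> p z w \<longrightarrow>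
         (\<forall>n\<ge>1. \<eta> n = C / sqrt (real n)) \<longrightarrow>
         integrable P (\<lambda>\<omega>. MIN n\<in>{1..N}. (norm (G (z n \<omega>)))\<^sup>2) \<and>
         (\<integral>\<omega>. (MIN n\<in>{1..N}. (norm (G (z n \<omega>)))\<^sup>2) \<partial>P) \<le> c * (ln (real N) / sqrt (real N)))"
proof -
  define F_inf where "F_inf = Inf (range F)"
  have lower: "F_inf \<le> F x" for x
    unfolding F_inf_def using below by (simp add: cInf_lower)
  define A where "A = (\<integral>\<omega>. F (w1 \<omega>) \<partial>P) - F_inf"
  define \<kappa> where "\<kappa> = M * \<nu> / (\<epsilon> + K)"
  define D where "D = drift_const L \<mu> M \<nu> \<epsilon> K B"
  have \<kappa>: "0 < \<kappa>" using M nu eps K by (simp add: \<kappa>_def)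
  interpret prob_space P by (rule prob)
  have A: "0 \<le> A"
    using integral_mono[of P "\<lambda>_. F_inf" "\<lambda>\<omega>. F (w1 \<omega>)"] F_initial lower
    by (simp add: A_def prob_space)
  have key: "integrable P (\<lambda>\<omega>. MIN n\<in>{1..N}. (norm (G (z n \<omega>)))\<^sup>2)"
      "\<kappa> * (\<Sum>n=1..N. \<eta> n) * (\<integral>\<omega>. (MIN n\<in>{1..N}. (norm (G (z n \<omega>)))\<^sup>2) \<partial>P) \<le> A + D * (\<Sum>n=1..N. (\<eta> n)\<^sup>2)"
      "0 \<le> (\<integral>\<omega>. (MIN n\<in>{1..N}. (norm (G (z n \<omega>)))\<^sup>2) \<partial>P)"
      "0 \<le> D"
    if run: "stochastic_aammsu P G L \<mu> M \<nu> \<epsilon> \<beta>2 \<sigma> K B \<theta>1 w1 N \<eta> \<gamma>t Fl g \<theta> p z w" and N: "N \<ge> 1"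
    for N \<eta> \<gamma>t Fl g \<theta> p z w
  proof -
    interpret R: stochastic_aammsu P G L \<mu> M \<nu> \<epsilon> \<beta>2 \<sigma> K B \<theta>1 w1 N \<eta> \<gamma>t Fl g \<theta> p z w by (rule run)
    interpret S: stochastic_smooth_aammsu P F G L F_inf \<mu> M \<nu> \<epsilon> \<beta>2 \<sigma> K B \<theta>1 w1 N \<eta> \<gamma>t Fl g \<theta> p z w
      by unfold_locales (use gradient L lipschitz lower mu M nu eps beta2 K F_initial in auto)
    show "integrable P (\<lambda>\<omega>. MIN n\<in>{1..N}. (norm (G (z n \<omega>)))\<^sup>2)" by (rule S.integrable_min[OF N])
    show "\<kappa> * (\<Sum>n=1..N. \<eta> n) * (\<integral>\<omega>. (MIN n\<in>{1..N}. (norm (G (z n \<omega>)))\<^sup>2) \<partial>P) \<le> A + D * (\<Sum>n=1..N. (\<eta> n)\<^sup>2)"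
      using S.expectation_min_le[OF N] by (simp add: A_def D_def \<kappa>_def)
    show "0 \<le> (\<integral>\<omega>. (MIN n\<in>{1..N}. (norm (G (z n \<omega>)))\<^sup>2) \<partial>P)"
      using N by (intro integral_nonneg_AE AE_I2 Min.boundedI) auto
    show "0 \<le> D"
      using S.B_nonneg L mu by (simp add: D_def drift_const_def)
  qed
  have rate_const: "(\<integral>\<omega>. (MIN n\<in>{1..N}. (norm (G (z n \<omega>)))\<^sup>2) \<partial>P) \<le> (A + D * C\<^sup>2) / (\<kappa> * C) * (1 / sqrt (real N))"
    if run: "stochastic_aammsu P G L \<mu> M \<nu> \<epsilon> \<beta>2 \<sigma> K B \<theta>1 w1 N \<eta> \<gamma>t Fl g \<theta> p z w" and N: "N \<ge> 1"
      and \<eta>: "\<forall>n\<in>{1..N}. \<eta> n = C / sqrt (real N)"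
    for N \<eta> \<gamma>t Fl g \<theta> p z w
  proof -
    have "(\<Sum>n=1..N. \<eta> n) = C * (real N / sqrt (real N))" using \<eta> by simp
    then have "(\<Sum>n=1..N. \<eta> n) = C * sqrt (real N)" by (simp only: real_div_sqrt of_nat_0_le_iff)
    moreover have "(\<Sum>n=1..N. (\<eta> n)\<^sup>2) = C\<^sup>2" using \<eta> N by (simp add: power_divide)
    ultimately show ?thesis
      using key(2)[OF run N] \<kappa> C N by (simp add: field_simps)
  qed
  have rate_log: "(\<integral>\<omega>. (MIN n\<in>{1..N}. (norm (G (z n \<omega>)))\<^sup>2) \<partial>P)
      \<le> (A / ln 2 + D * C\<^sup>2 * (1 / ln 2 + 1)) / (\<kappa> * C) * (ln (real N) / sqrt (real N))"
    if run: "stochastic_aammsu P G L \<mu> M \<nu> \<epsilon> \<beta>2 \<sigma> K B \<theta>1 w1 N \<eta> \<gamma>t Fl g \<theta> p z w" and N: "N \<ge> 2"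
      and \<eta>: "\<forall>n\<ge>1. \<eta> n = C / sqrt (real n)"
    for N \<eta> \<gamma>t Fl g \<theta> p z w
  proof -
    let ?m = "\<integral>\<omega>. (MIN n\<in>{1..N}. (norm (G (z n \<omega>)))\<^sup>2) \<partial>P"
    have N1: "N \<ge> 1" using N by simp
    have "C * sqrt (real N) = C * (real N / sqrt (real N))" by (simp only: real_div_sqrt of_nat_0_le_iff)
    also have "\<dots> = (\<Sum>n=1..N. C / sqrt (real N))" by simp
    also have "\<dots> \<le> (\<Sum>n=1..N. \<eta> n)"
      using \<eta> C by (intro sum_mono) (auto intro!: divide_left_mono)
    finally have "\<kappa> * (C * sqrt (real N)) * ?m \<le> \<kappa> * (\<Sum>n=1..N. \<eta> n) * ?m"
      using \<kappa> key(3)[OF run N1] by (intro mult_right_mono mult_left_mono) auto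
    also have "\<dots> \<le> A + D * (\<Sum>n=1..N. (\<eta> n)\<^sup>2)" by (rule key(2)[OF run N1])
    also have "(\<Sum>n=1..N. (\<eta> n)\<^sup>2) = C\<^sup>2 * (\<Sum>n=1..N. 1 / real n)"
      using \<eta> by (simp add: power_divide sum_distrib_left)
    \<comment> \<open>For \<open>N \<ge> 2\<close> constants are absorbed into the logarithm because \<open>ln N \<ge> ln 2\<close>.\<close>
    also have "A + D * (C\<^sup>2 * (\<Sum>n=1..N. 1 / real n))
        \<le> A / ln 2 * ln (real N) + D * (C\<^sup>2 * ((1 / ln 2 + 1) * ln (real N)))"
    proof -
      have "ln 2 \<le> ln (real N)" using N by simp
      then have "A * 1 \<le> A * (ln (real N) / ln 2)" using A by (intro mult_left_mono) auto
      then show ?thesis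
        using key(4)[OF run N1] sum_inverse_le_ln[OF N] by (intro add_mono mult_left_mono) auto
    qed
    also have "\<dots> = (A / ln 2 + D * C\<^sup>2 * (1 / ln 2 + 1)) * ln (real N)"
      by (simp add: algebra_simps)
    finally have "?m \<le> ((A / ln 2 + D * C\<^sup>2 * (1 / ln 2 + 1)) * ln (real N)) / (\<kappa> * (C * sqrt (real N)))"
      using \<kappa> C N by (subst pos_le_divide_eq) (auto simp: mult_ac)
    then show ?thesis by (simp add: mult_ac)
  qed
  show ?thesis
  proof (rule conjI; rule exI; intro allI impI; rule conjI)
    fix N \<eta> \<gamma>t Fl g \<theta> p z w
    assume run: "stochastic_aammsu P G L \<mu> M \<nu> \<epsilon> \<beta>2 \<sigma> K B \<theta>1 w1 N \<eta> \<gamma>t Fl g \<theta> p z w"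
    {
      assume N: "N \<ge> 1" and \<eta>: "\<forall>n\<in>{1..N}. \<eta> n = C / sqrt (real N)"
      show "integrable P (\<lambda>\<omega>. MIN n\<in>{1..N}. (norm (G (z n \<omega>)))\<^sup>2)"
        by (rule key(1)[OF run N])
      show "(\<integral>\<omega>. (MIN n\<in>{1..N}. (norm (G (z n \<omega>)))\<^sup>2) \<partial>P) \<le> (A + D * C\<^sup>2) / (\<kappa> * C) * (1 / sqrt (real N))"
        by (rule rate_const[OF run N \<eta>])
    next
      assume N: "N \<ge> 2" and "\<forall>n\<ge>1. \<eta> n = C / sqrt (real n)"
      then show "(\<integral>\<omega>. (MIN n\<in>{1..N}. (norm (G (z n \<omega>)))\<^sup>2) \<partial>P)
          \<le> (A / ln 2 + D * C\<^sup>2 * (1 / ln 2 + 1)) / (\<kappa> * C) * (ln (real N) / sqrt (real N))"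
        by (rule rate_log[OF run])
      have "N \<ge> 1" using N by simp
      then show "integrable P (\<lambda>\<omega>. MIN n\<in>{1..N}. (norm (G (z n \<omega>)))\<^sup>2)"
        by (rule key(1)[OF run])
    }
  qed
qed

end
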